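(* Let $Y$ be an $\omega$-Lawson semitopological semilattice and let $X$ be a complete subsemilattice of $Y$ (where $X$ carries the subspace topology). Then the natural partial order $\le_X=\{(x,y)\in X\times X: xy=x\}$ of $X$ is a closed subset of $Y\times Y$. Consequently, $X$ is closed in $Y$.
   Context: A semilattice is a commutative semigroup all of whose elements are idempotents ($xx=x$). It carries the natural partial order $x\le y$ iff $xy=x$. A subset $C$ of a semilattice is a chain if $xy\in\{x,y\}$ for all $x,y\in C$. A topologized semilattice is a semilattice endowed with a topology; it is semitopological if its operation $(x,y)\mapsto xy$ is separately continuous. A topologized semilattice $X$ is complete if for each non-empty chain $C\subset X$ both $\inf C$ and $\sup C$ (with respect to the natural partial order) exist in $X$ and belong to the closure $\overline{C}$ of $C$ in $X$. A closed neighborhood of a point $x$ is a closed set containing $x$ in its interior. A topologized semilattice $Y$ is $\omega$-Lawson if for any distinct points $x,y\in Y$ there exists a countable family $\mathcal U$ of closed neighborhoods of $x$ such that $\bigcap\mathcal U$ is a subsemilattice of $Y$ that does not contain $y$. The set $Y\times Y$ carries the product topology. *)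

theory Defs
  imports "HOL-Analysis.Analysis"
begin

definition semitopological_semilattice :: "('a::topological_space \<Rightarrow> 'a \<Rightarrow> 'a) \<Rightarrow> bool" where
  "semitopological_semilattice f \<longleftrightarrow>
     semilattice f \<and>
     (\<forall>a. continuous_on UNIV (\<lambda>x. f a x)) \<and> (\<forall>a. continuous_on UNIV (\<lambda>x. f x a))"

definition subsemilattice :: "('a \<Rightarrow> 'a \<Rightarrow> 'a) \<Rightarrow> 'a set \<Rightarrow> bool" where
  "subsemilattice f X \<longleftrightarrow> (\<forall>x\<in>X. \<forall>y\<in>X. f x y \<in> X)"

definition natural_le :: "('a \<Rightarrow> 'a \<Rightarrow> 'a) \<Rightarrow> 'a \<Rightarrow> 'a \<Rightarrow> bool" where
  "natural_le f x y \<longleftrightarrow> f x y = x"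

definition natural_order_on :: "'a set \<Rightarrow> ('a \<Rightarrow> 'a \<Rightarrow> 'a) \<Rightarrow> ('a \<times> 'a) set" where
  "natural_order_on X f = {(x, y) \<in> X \<times> X. natural_le f x y}"

definition semilattice_chain :: "('a \<Rightarrow> 'a \<Rightarrow> 'a) \<Rightarrow> 'a set \<Rightarrow> bool" where
  "semilattice_chain f C \<longleftrightarrow> (\<forall>x\<in>C. \<forall>y\<in>C. f x y \<in> {x, y})"

text \<open>
  Infima and suprema are taken relative to a carrier \<open>X\<close>: the bounds range over \<open>X\<close> only.
\<close>

definition is_inf_in :: "'a set \<Rightarrow> ('a \<Rightarrow> 'a \<Rightarrow> 'a) \<Rightarrow> 'a set \<Rightarrow> 'a \<Rightarrow> bool" where
  "is_inf_in X f C m \<longleftrightarrow>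
     m \<in> X \<and> (\<forall>c\<in>C. natural_le f m c) \<and>
     (\<forall>l\<in>X. (\<forall>c\<in>C. natural_le f l c) \<longrightarrow> natural_le f l m)"

definition is_sup_in :: "'a set \<Rightarrow> ('a \<Rightarrow> 'a \<Rightarrow> 'a) \<Rightarrow> 'a set \<Rightarrow> 'a \<Rightarrow> bool" where
  "is_sup_in X f C m \<longleftrightarrow>
     m \<in> X \<and> (\<forall>c\<in>C. natural_le f c m) \<and>
     (\<forall>u\<in>X. (\<forall>c\<in>C. natural_le f c u) \<longrightarrow> natural_le f m u)"

text \<open>
  The topologized semilattice is \<open>topspace T\<close> with topology \<open>T\<close> and the restriction of \<open>f\<close>;
  for a subsemilattice \<open>X\<close> with its subspace topology, \<open>T\<close> is \<open>top_of_set X\<close>.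
\<close>

definition complete_topologized_semilattice :: "'a topology \<Rightarrow> ('a \<Rightarrow> 'a \<Rightarrow> 'a) \<Rightarrow> bool" where
  "complete_topologized_semilattice T f \<longleftrightarrow>
     (\<forall>C. C \<subseteq> topspace T \<and> C \<noteq> {} \<and> semilattice_chain f C \<longrightarrow>
        (\<exists>m. is_inf_in (topspace T) f C m \<and> m \<in> T closure_of C) \<and>
        (\<exists>m. is_sup_in (topspace T) f C m \<and> m \<in> T closure_of C))"

definition closed_neighborhood :: "'a::topological_space \<Rightarrow> 'a set \<Rightarrow> bool" where
  "closed_neighborhood x U \<longleftrightarrow> closed U \<and> x \<in> interior U"

definition omega_Lawson :: "('a::topological_space \<Rightarrow> 'a \<Rightarrow> 'a) \<Rightarrow> bool" where
  "omega_Lawson f \<longleftrightarrow>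
     (\<forall>x y. x \<noteq> y \<longrightarrow>
        (\<exists>\<U>. countable \<U> \<and> (\<forall>U\<in>\<U>. closed_neighborhood x U) \<and>
             subsemilattice f (\<Inter>\<U>) \<and> y \<notin> \<Inter>\<U>))"

end

theory Submission
  imports Defs
begin

text \<open>
  Write \<open>x \<le> y\<close> for \<open>natural_le f x y\<close>. The theorem reduces to the closedness of complete
  subsemilattices, theorem \<open>complete_subsemilattice_closed\<close>: the order relation of \<open>X\<close> is itself a
  subsemilattice \<open>Z\<close> of the square \<open>Y \<times> Y\<close>, the square is again semitopological and
  \<open>\<omega>\<close>-Lawson, and \<open>Z\<close> is complete (lemma \<open>complete_natural_order_on\<close>). Hence \<open>Z\<close> is closed, and
  \<open>X\<close> is closed because it is the preimage of \<open>Z\<close> under the continuous diagonal map.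
  Completeness of \<open>Z\<close> is not a formal consequence of that of \<open>X\<close>, since membership of two points
  in closures does not give membership of the pair. It holds because chains in a complete semilattice
  converge to their bounds: if a chain met the complement of a neighborhood of its infimum
  arbitrarily far down, that part of the chain would have the same infimum, which would then lie in
  its closure.

  Closedness of a complete \<open>X\<close> rests on two intersection properties, applied at a point \<open>x\<close> of the
  closure of \<open>X\<close>.

  The first one, \<open>complete_meets_countable_Inter\<close>, says that \<open>X\<close> meets the intersection of
  countably many closed neighborhoods \<open>U\<^sub>0, U\<^sub>1, \<dots>\<close> of \<open>x\<close>, which may be assumed decreasing. As
  \<open>xx = x\<close> and the operation is separately continuous, one can choose \<open>x\<^sub>0, x\<^sub>1, \<dots>\<close> in \<open>X\<close> so
  close to \<open>x\<close> that every product \<open>x\<^sub>i \<dots> x\<^sub>n\<close> lies in \<open>U\<^sub>i\<close>. For fixed \<open>i\<close> these products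
  decrease, their infimum \<open>y\<^sub>i\<close> lies in \<open>U\<^sub>i\<close>, the \<open>y\<^sub>i\<close> increase, and their supremum, being the
  supremum of every tail, lies in every \<open>U\<^sub>n\<close>.

  The second one, \<open>closed_subsemilattices_meet\<close>, is a compactness property of \<open>X\<close>: closed
  subsemilattices, each meeting \<open>X\<close> and forming a family stable under binary intersection, have a
  common point in \<open>X\<close>. Apply it to all subsemilattices that are intersections of countably
  many closed neighborhoods of \<open>x\<close>. Each of them meets \<open>X\<close> by the first property, and since \<open>Y\<close> is
  \<open>\<omega>\<close>-Lawson their only common point is \<open>x\<close>; so \<open>x \<in> X\<close>.
\<close>

section \<open>The natural order\<close>

lemma natural_le_refl: "semilattice f \<Longrightarrow> natural_le f x x"
  unfolding natural_le_def by (metis semilattice.idem)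

lemma natural_le_trans:
  "semilattice f \<Longrightarrow> natural_le f x y \<Longrightarrow> natural_le f y z \<Longrightarrow> natural_le f x z"
  unfolding natural_le_def by (metis semilattice_def abel_semigroup_def semigroup.assoc)

lemma natural_le_antisym:
  "semilattice f \<Longrightarrow> natural_le f x y \<Longrightarrow> natural_le f y x \<Longrightarrow> x = y"
  unfolding natural_le_def by (metis semilattice_def abel_semigroup.commute)

lemma natural_le_left:
  assumes "semilattice f"
  shows "natural_le f (f x y) x"
proof -
  interpret semilattice f by fact
  show ?thesis by (simp add: natural_le_def ac_simps)
qed

lemma natural_le_right:
  assumes "semilattice f"
  shows "natural_le f (f x y) y"
proof -
  interpret semilattice f by fact
  show ?thesis by (simp add: natural_le_def ac_simps)
qed

lemma natural_le_mult:
  assumes "semilattice f" "natural_le f a b" "natural_le f c d"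
  shows "natural_le f (f a c) (f b d)"
proof -
  interpret semilattice f by fact
  have "f (f a c) (f b d) = f (f a b) (f c d)" by (simp add: ac_simps)
  then show ?thesis using assms by (simp add: natural_le_def)
qed

lemma natural_le_mult_right:
  "semilattice f \<Longrightarrow> natural_le f a b \<Longrightarrow> natural_le f (f a c) (f b c)"
  by (simp add: natural_le_mult natural_le_refl)

lemma semilattice_chain_iff:
  assumes "semilattice f"
  shows "semilattice_chain f C \<longleftrightarrow> (\<forall>x\<in>C. \<forall>y\<in>C. natural_le f x y \<or> natural_le f y x)"
proof -
  interpret semilattice f by fact
  have "f x y \<in> {x, y} \<longleftrightarrow> natural_le f x y \<or> natural_le f y x" for x y
    by (simp add: natural_le_def commute[of y x])
  then show ?thesis by (simp add: semilattice_chain_def)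
qed

lemma natural_le_maximal_exists:
  assumes "semilattice f" "A \<noteq> {}"
    and bound: "\<And>C. C \<subseteq> A \<Longrightarrow> C \<noteq> {} \<Longrightarrow> semilattice_chain f C \<Longrightarrow> \<exists>u\<in>A. \<forall>c\<in>C. natural_le f c u"
  shows "\<exists>m\<in>A. \<forall>a\<in>A. natural_le f m a \<longrightarrow> a = m"
proof (rule predicate_Zorn)
  show "partial_order_on A (relation_of (natural_le f) A)"
    by (rule partial_order_on_relation_ofI)
      (blast intro: natural_le_refl[OF assms(1)] natural_le_trans[OF assms(1)]
         natural_le_antisym[OF assms(1)])+
  fix C assume "C \<in> Chains (relation_of (natural_le f) A)"
  then have "C \<subseteq> A" "semilattice_chain f C"
    by (auto simp: Chains_def relation_of_def semilattice_chain_iff[OF assms(1)])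
  then show "\<exists>u\<in>A. \<forall>a\<in>C. natural_le f a u"
    using bound assms(2) by (cases "C = {}") auto
qed

text \<open>
  Zorn's lemma for the reversed order gives a minimal element, and a minimal element \<open>m\<close> of a
  subsemilattice is least, because \<open>m s\<close> lies below both \<open>m\<close> and \<open>s\<close>.
\<close>

lemma subsemilattice_least_exists:
  assumes sl: "semilattice f" and "subsemilattice f S" "S \<noteq> {}"
    and bound: "\<And>C. C \<subseteq> S \<Longrightarrow> C \<noteq> {} \<Longrightarrow> semilattice_chain f C \<Longrightarrow> \<exists>l\<in>S. \<forall>c\<in>C. natural_le f l c"
  shows "\<exists>m\<in>S. \<forall>s\<in>S. natural_le f m s"
proof -
  have "\<exists>m\<in>S. \<forall>a\<in>S. natural_le f a m \<longrightarrow> a = m"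
  proof (rule predicate_Zorn)
    show "partial_order_on S (relation_of (\<lambda>x y. natural_le f y x) S)"
      by (rule partial_order_on_relation_ofI)
        (blast intro: natural_le_refl[OF sl] natural_le_trans[OF sl] natural_le_antisym[OF sl])+
    fix C assume "C \<in> Chains (relation_of (\<lambda>x y. natural_le f y x) S)"
    then have "C \<subseteq> S" "semilattice_chain f C"
      by (auto simp: Chains_def relation_of_def semilattice_chain_iff[OF sl])
    then show "\<exists>u\<in>S. \<forall>a\<in>C. natural_le f u a"
      using bound assms(3) by (cases "C = {}") auto
  qed
  then show ?thesis
    by (metis assms(2) natural_le_left[OF sl] natural_le_right[OF sl] subsemilattice_def)
qed

section \<open>Complete subsemilattices\<close>

text \<open>
  Infima and suprema relative to \<open>X\<close> lie in \<open>X\<close> anyway, so the closure in the subspace \<open>X\<close> can be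
  replaced by the closure in the ambient space.
\<close>

lemma complete_topologized_semilattice_iff:
  "complete_topologized_semilattice (top_of_set X) f \<longleftrightarrow>
     (\<forall>C. C \<subseteq> X \<and> C \<noteq> {} \<and> semilattice_chain f C \<longrightarrow>
        (\<exists>m. is_inf_in X f C m \<and> m \<in> closure C) \<and> (\<exists>m. is_sup_in X f C m \<and> m \<in> closure C))"
proof -
  have "is_inf_in X f C m \<and> m \<in> top_of_set X closure_of C \<longleftrightarrow> is_inf_in X f C m \<and> m \<in> closure C"
    "is_sup_in X f C m \<and> m \<in> top_of_set X closure_of C \<longleftrightarrow> is_sup_in X f C m \<and> m \<in> closure C"
    if "C \<subseteq> X" for C m
    using that by (auto simp: closure_of_subtopology Int_absorb1 is_inf_in_def is_sup_in_def)
  then show ?thesis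
    unfolding complete_topologized_semilattice_def topspace_euclidean_subtopology
    by (intro all_cong) auto
qed

lemma complete_inf:
  assumes "complete_topologized_semilattice (top_of_set X) f"
    and "C \<subseteq> X" "C \<noteq> {}" "semilattice_chain f C"
  shows "\<exists>m. is_inf_in X f C m \<and> m \<in> closure C"
  using assms unfolding complete_topologized_semilattice_iff by blast

lemma complete_sup:
  assumes "complete_topologized_semilattice (top_of_set X) f"
    and "C \<subseteq> X" "C \<noteq> {}" "semilattice_chain f C"
  shows "\<exists>m. is_sup_in X f C m \<and> m \<in> closure C"
  using assms unfolding complete_topologized_semilattice_iff by blast

text \<open>
  The part of \<open>K \<inter> X\<close> above \<open>a\<close> contains the infimum of each of its chains: the infimum stays in
  \<open>K\<close> because it is in the closure of the chain, and it stays above \<open>a\<close> because \<open>a\<close> is a lower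
  bound. So this part has a least element.
\<close>

lemma least_above_in_closed:
  assumes sl: "semilattice f" and X: "subsemilattice f X"
    and com: "complete_topologized_semilattice (top_of_set X) f"
    and K: "closed K" "subsemilattice f K"
    and a: "a \<in> X" and ne: "\<exists>z\<in>K \<inter> X. natural_le f a z"
  shows "\<exists>m\<in>K \<inter> X. natural_le f a m \<and> (\<forall>z\<in>K \<inter> X. natural_le f a z \<longrightarrow> natural_le f m z)"
proof -
  let ?S = "{z \<in> K \<inter> X. natural_le f a z}"
  have "\<exists>m\<in>?S. \<forall>s\<in>?S. natural_le f m s"
  proof (rule subsemilattice_least_exists[OF sl])
    show "subsemilattice f ?S"
      using X K(2) natural_le_mult[OF sl, of a _ a] semilattice.idem[OF sl, of a]
      by (auto simp: subsemilattice_def)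
    show "?S \<noteq> {}" using ne by auto
    fix C assume C: "C \<subseteq> ?S" "C \<noteq> {}" "semilattice_chain f C"
    then obtain m where m: "is_inf_in X f C m" "m \<in> closure C"
      using complete_inf[OF com, of C] by blast
    have "m \<in> K" using m(2) C(1) closure_minimal[OF _ K(1), of C] by auto
    with m C a show "\<exists>l\<in>?S. \<forall>c\<in>C. natural_le f l c"
      by (intro bexI[of _ m]) (auto simp: is_inf_in_def)
  qed
  then show ?thesis by auto
qed

text \<open>
  Let \<open>D\<close> consist of the points of \<open>X\<close> that lie below some point of each \<open>K \<inter> X\<close>. A maximal
  element \<open>a\<close> of \<open>D\<close> is a common point: for \<open>L \<in> F\<close>, the least element \<open>m\<close> of \<open>L \<inter> X\<close>
  above \<open>a\<close> is again in \<open>D\<close>, since each \<open>L \<inter> M\<close> has a point above \<open>a\<close>, which is then above \<open>m\<close>;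
  so \<open>m = a\<close>.
\<close>

lemma closed_subsemilattices_meet:
  assumes sl: "semilattice f" and X: "subsemilattice f X"
    and com: "complete_topologized_semilattice (top_of_set X) f"
    and F: "F \<noteq> {}" "\<And>K L. K \<in> F \<Longrightarrow> L \<in> F \<Longrightarrow> K \<inter> L \<in> F"
    and K: "\<And>K. K \<in> F \<Longrightarrow> closed K \<and> subsemilattice f K \<and> K \<inter> X \<noteq> {}"
  shows "\<exists>a\<in>X. \<forall>K\<in>F. a \<in> K"
proof -
  define D where "D = {a \<in> X. \<forall>K\<in>F. \<exists>z\<in>K \<inter> X. natural_le f a z}"
  \<comment> \<open>The least element of \<open>X\<close> shows that \<open>D\<close> is inhabited, as Zorn's lemma requires.\<close>
  have "\<exists>b\<in>X. \<forall>s\<in>X. natural_le f b s"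
  proof (rule subsemilattice_least_exists[OF sl X])
    show "X \<noteq> {}" using F(1) K by blast
    show "\<exists>l\<in>X. \<forall>c\<in>C. natural_le f l c"
      if "C \<subseteq> X" "C \<noteq> {}" "semilattice_chain f C" for C
      using complete_inf[OF com that] unfolding is_inf_in_def by blast
  qed
  then have "D \<noteq> {}" unfolding D_def using K by blast
  have "\<exists>a\<in>D. \<forall>b\<in>D. natural_le f a b \<longrightarrow> b = a"
  proof (rule natural_le_maximal_exists[OF sl \<open>D \<noteq> {}\<close>])
    fix C assume C: "C \<subseteq> D" "C \<noteq> {}" "semilattice_chain f C"
    then have CX: "C \<subseteq> X" by (auto simp: D_def)
    obtain s where s: "is_sup_in X f C s" using complete_sup[OF com CX C(2,3)] by blast
    \<comment> \<open>The points \<open>m c\<close>, least in \<open>L \<inter> X\<close> above \<open>c\<close>, form a chain; its supremum is in \<open>L\<close>, above \<open>s\<close>.\<close>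
    have "\<exists>z\<in>L \<inter> X. natural_le f s z" if L: "L \<in> F" for L
    proof -
      have "\<exists>m\<in>L \<inter> X. natural_le f c m \<and> (\<forall>z\<in>L \<inter> X. natural_le f c z \<longrightarrow> natural_le f m z)"
        if "c \<in> C" for c
        by (rule least_above_in_closed[OF sl X com]) (use K[OF L] C CX L that in \<open>auto simp: D_def\<close>)
      then obtain m where m: "\<And>c. c \<in> C \<Longrightarrow> m c \<in> L \<inter> X \<and> natural_le f c (m c) \<and>
          (\<forall>z\<in>L \<inter> X. natural_le f c z \<longrightarrow> natural_le f (m c) z)"
        by metis
      have "natural_le f (m c) (m d)" if "c \<in> C" "d \<in> C" "natural_le f c d" for c d
        using m[OF that(1)] m[OF that(2)] natural_le_trans[OF sl that(3)] by blast
      then have "semilattice_chain f (m ` C)"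
        using C(3) unfolding semilattice_chain_iff[OF sl] ball_simps by blast
      moreover have "m ` C \<subseteq> X" using m by auto
      ultimately obtain t where t: "is_sup_in X f (m ` C) t" "t \<in> closure (m ` C)"
        using complete_sup[OF com, of "m ` C"] C(2) by blast
      have "t \<in> L" using t(2) closure_minimal[of "m ` C" L] m K[OF L] by blast
      moreover have "natural_le f c t" if "c \<in> C" for c
        using t(1) m[OF that] that natural_le_trans[OF sl] unfolding is_sup_in_def by blast
      ultimately show ?thesis using s t(1) unfolding is_sup_in_def by blast
    qed
    then have "s \<in> D" using s by (auto simp: D_def is_sup_in_def)
    then show "\<exists>u\<in>D. \<forall>c\<in>C. natural_le f c u" using s unfolding is_sup_in_def by blast
  qed
  then obtain a where a: "a \<in> D" "\<And>b. b \<in> D \<Longrightarrow> natural_le f a b \<Longrightarrow> b = a" by blast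
  have "a \<in> L" if L: "L \<in> F" for L
  proof -
    have "\<exists>m\<in>L \<inter> X. natural_le f a m \<and> (\<forall>z\<in>L \<inter> X. natural_le f a z \<longrightarrow> natural_le f m z)"
      by (rule least_above_in_closed[OF sl X com]) (use K[OF L] L a(1) in \<open>auto simp: D_def\<close>)
    then obtain m where m: "m \<in> L \<inter> X" "natural_le f a m"
        "\<And>z. z \<in> L \<inter> X \<Longrightarrow> natural_le f a z \<Longrightarrow> natural_le f m z" by blast
    have "\<exists>z\<in>M \<inter> X. natural_le f m z" if M: "M \<in> F" for M
    proof -
      obtain z where "z \<in> (L \<inter> M) \<inter> X" "natural_le f a z"
        using a(1) F(2)[OF L M] unfolding D_def by blast
      then show ?thesis using m(3)[of z] by blast
    qed
    then have "m \<in> D" using m(1) by (auto simp: D_def)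
    then show ?thesis using a(2) m by blast
  qed
  then show ?thesis using a(1) by (auto simp: D_def)
qed

section \<open>Closedness of complete subsemilattices\<close>

lemma semitopological_semilatticeD:
  assumes "semitopological_semilattice f"
  shows "semilattice f" "open W \<Longrightarrow> open {z. f a z \<in> W}" "open W \<Longrightarrow> open {z. f z a \<in> W}"
proof -
  show "semilattice f" using assms by (simp add: semitopological_semilattice_def)
  have "continuous_on UNIV (\<lambda>z. f a z)" "continuous_on UNIV (\<lambda>z. f z a)"
    using assms by (auto simp: semitopological_semilattice_def)
  then show "open W \<Longrightarrow> open {z. f a z \<in> W}" "open W \<Longrightarrow> open {z. f z a \<in> W}"
    by (auto simp: continuous_on_open_vimage vimage_def)
qed

text \<open>
  The point \<open>p n i\<close> is the product \<open>x\<^sub>i \<dots> x\<^sub>n\<close> of points \<open>x\<^sub>0, x\<^sub>1, \<dots>\<close> of \<open>X\<close> chosen successively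
  near \<open>x\<close>. Only the finitely many products ending in \<open>x\<^sub>n\<close> matter for the choice of \<open>x\<^bsub>n+1\<^esub>\<close>, so
  the recursion is on the rows \<open>p n\<close> rather than on the points themselves.
\<close>

lemma closure_product_sequence:
  fixes f :: "'a::topological_space \<Rightarrow> 'a \<Rightarrow> 'a"
  assumes st: "semitopological_semilattice f" and X: "subsemilattice f X"
    and x: "x \<in> closure X"
    and W: "\<And>n. open (W n)" "\<And>n. x \<in> W n"
  obtains p :: "nat \<Rightarrow> nat \<Rightarrow> 'a" where
    "\<And>n i. i \<le> n \<Longrightarrow> p n i \<in> X \<inter> W i"
    "\<And>n i. i < n \<Longrightarrow> natural_le f (p n i) (p n (Suc i))"
    "\<And>n i. i \<le> n \<Longrightarrow> natural_le f (p (Suc n) i) (p n i)"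
proof -
  note sl = semitopological_semilatticeD(1)[OF st]
  interpret semilattice f by fact
  \<comment> \<open>The condition \<open>f (q i) x \<in> W i\<close> says that the limiting choice \<open>x\<close> of the next factor keeps
    the product in the open set \<open>W i\<close>; by continuity, so do all choices close to \<open>x\<close>.\<close>
  define P where "P = (\<lambda>(n::nat) q. (\<forall>i\<le>n. q i \<in> X \<inter> W i \<and> f (q i) x \<in> W i) \<and>
     (\<forall>i<n. natural_le f (q i) (q (Suc i))))"
  define Q where "Q = (\<lambda>(n::nat) q q'. \<forall>i\<le>n. natural_le f (q' i) (q i))"
  have near: "\<exists>z\<in>X. z \<in> N" if "open N" "x \<in> N" for N
    using x that unfolding closure_iff_nhds_not_empty by (metis disjoint_iff subset_refl)
  have fresh: "open {z. z \<in> W n \<and> f z x \<in> W n}" for n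
    by (simp add: open_Collect_conj semitopological_semilatticeD(3)[OF st] W)
  have "\<exists>p. \<forall>n. P n (p n) \<and> Q n (p n) (p (Suc n))"
  proof (rule dependent_nat_choice)
    obtain z where "z \<in> X" "z \<in> W 0 \<and> f z x \<in> W 0"
      using near[OF fresh[of 0]] W by auto
    then show "\<exists>q. P 0 q" by (intro exI[of _ "\<lambda>_. z"]) (auto simp: P_def)
  next
    fix q n assume q: "P n q"
    let ?N = "{z. z \<in> W (Suc n) \<and> f z x \<in> W (Suc n)} \<inter>
      (\<Inter>i\<in>{..n}. {z. f (q i) z \<in> W i} \<inter> {z. f (f (q i) x) z \<in> W i})"
    have "open ?N"
      by (intro open_Int fresh open_INT ballI semitopological_semilatticeD(2)[OF st] W) auto
    moreover have "x \<in> ?N" using q W by (auto simp: P_def)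
    ultimately obtain z where z: "z \<in> X" "z \<in> ?N" using near by blast
    let ?q = "\<lambda>i. if i \<le> n then f (q i) z else z"
    have "P (Suc n) ?q"
      unfolding P_def
    proof (intro conjI allI impI)
      fix i assume "i < Suc n"
      then show "natural_le f (?q i) (?q (Suc i))"
        using q natural_le_mult_right[OF sl] natural_le_right[OF sl]
        by (cases "i = n") (auto simp: P_def)
    next
      fix i assume i: "i \<le> Suc n"
      show "?q i \<in> X \<inter> W i"
        using i z q X by (auto simp: P_def subsemilattice_def le_Suc_eq)
      \<comment> \<open>At \<open>z = x\<close> this value is \<open>f (q i) x\<close> by idempotency, so it is in \<open>W i\<close> for \<open>z\<close> near \<open>x\<close>.\<close>
      have "f (f (q i) z) x = f (f (q i) x) z" by (simp add: ac_simps)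
      then show "f (?q i) x \<in> W i" using i z by (auto simp: le_Suc_eq)
    qed
    moreover have "Q n q ?q" by (simp add: Q_def natural_le_left[OF sl])
    ultimately show "\<exists>q'. P (Suc n) q' \<and> Q n q q'" by blast
  qed
  then obtain p where "\<And>n. P n (p n)" "\<And>n. Q n (p n) (p (Suc n))" by blast
  then show thesis by (intro that[of p]) (auto simp: P_def Q_def)
qed

lemma complete_meets_decreasing:
  assumes st: "semitopological_semilattice f" and X: "subsemilattice f X"
    and com: "complete_topologized_semilattice (top_of_set X) f"
    and x: "x \<in> closure X"
    and U: "\<And>n :: nat. closed_neighborhood x (U n)" "antimono U"
  shows "\<exists>s\<in>X. \<forall>n. s \<in> U n"
proof -
  note sl = semitopological_semilatticeD(1)[OF st]
  obtain p where pXU: "\<And>n i. i \<le> n \<Longrightarrow> p n i \<in> X \<inter> interior (U i)"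
    and p_up: "\<And>n i. i < n \<Longrightarrow> natural_le f (p n i) (p n (Suc i))"
    and p_down: "\<And>n i. i \<le> n \<Longrightarrow> natural_le f (p (Suc n) i) (p n i)"
    by (rule closure_product_sequence[OF st X x, where W = "\<lambda>n. interior (U n)"])
      (use U(1) in \<open>auto simp: closed_neighborhood_def\<close>)
  have mono: "natural_le f (p n i) (p k i)" if "i \<le> k" "k \<le> n" for i k n :: nat
    using that(2)
  proof (induction rule: dec_induct)
    case base show ?case by (rule natural_le_refl[OF sl])
  next
    case (step n)
    then show ?case using p_down[of i n] that(1) natural_le_trans[OF sl] by (meson le_trans)
  qed
  have "\<exists>y. is_inf_in X f ((\<lambda>n. p n i) ` {i..}) y \<and> y \<in> closure ((\<lambda>n. p n i) ` {i..})" for i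
  proof (rule complete_inf[OF com])
    show "(\<lambda>n. p n i) ` {i..} \<subseteq> X" using pXU by auto
    show "semilattice_chain f ((\<lambda>n. p n i) ` {i..})"
      unfolding semilattice_chain_iff[OF sl] using mono by (auto) (metis nat_le_linear)
  qed auto
  then obtain y where y: "\<And>i. is_inf_in X f ((\<lambda>n. p n i) ` {i..}) (y i)"
    and yc: "\<And>i. y i \<in> closure ((\<lambda>n. p n i) ` {i..})" by metis
  have yX: "y i \<in> X" for i using y[of i] by (simp add: is_inf_in_def)
  have yU: "y i \<in> U i" for i
  proof -
    have "(\<lambda>n. p n i) ` {i..} \<subseteq> U i" using pXU interior_subset by fastforce
    then show ?thesis using yc[of i] U(1)[of i] closure_minimal
      unfolding closed_neighborhood_def by blast
  qed
  have "natural_le f (y i) (y (Suc i))" for i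
  proof -
    have "natural_le f (y i) (p n (Suc i))" if "n \<ge> Suc i" for n
    proof -
      have "natural_le f (y i) (p n i)" using y[of i] that by (auto simp: is_inf_in_def)
      then show ?thesis using p_up[of i n] that natural_le_trans[OF sl] by (meson Suc_le_eq)
    qed
    then show ?thesis using y[of "Suc i"] yX[of i] by (auto simp: is_inf_in_def)
  qed
  note y_step = this
  have ymono: "natural_le f (y i) (y j)" if "i \<le> j" for i j :: nat
    using that
  proof (induction rule: dec_induct)
    case base show ?case by (rule natural_le_refl[OF sl])
  next
    case (step n) then show ?case using natural_le_trans[OF sl] y_step by blast
  qed
  have "\<exists>s. is_sup_in X f (y ` {n..}) s \<and> s \<in> closure (y ` {n..})" for n
  proof (rule complete_sup[OF com])
    show "y ` {n..} \<subseteq> X" using yX by auto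
    show "semilattice_chain f (y ` {n..})"
      unfolding semilattice_chain_iff[OF sl] using ymono by (auto) (metis nat_le_linear)
  qed auto
  then obtain s where s: "\<And>n. is_sup_in X f (y ` {n..}) (s n)"
    and sc: "\<And>n. s n \<in> closure (y ` {n..})" by metis
  \<comment> \<open>An increasing sequence and its tails have the same supremum.\<close>
  have "s n = s 0" for n
  proof (rule natural_le_antisym[OF sl])
    show "natural_le f (s n) (s 0)" using s[of n] s[of 0] by (auto simp: is_sup_in_def)
    have "natural_le f (y i) (s n)" for i
    proof -
      have "natural_le f (y (max i n)) (s n)" using s[of n] by (auto simp: is_sup_in_def)
      then show ?thesis using ymono[of i "max i n"] natural_le_trans[OF sl] by (meson max.cobounded1)
    qed
    then show "natural_le f (s 0) (s n)" using s[of n] s[of 0] by (auto simp: is_sup_in_def)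
  qed
  moreover have "s n \<in> U n" for n
  proof -
    have "y ` {n..} \<subseteq> U n" using yU U(2) unfolding antimono_def by fastforce
    then show ?thesis using sc[of n] U(1)[of n] closure_minimal
      unfolding closed_neighborhood_def by blast
  qed
  ultimately show ?thesis using s[of 0] unfolding is_sup_in_def by metis
qed

lemma complete_meets_countable_Inter:
  assumes st: "semitopological_semilattice f" and X: "subsemilattice f X"
    and com: "complete_topologized_semilattice (top_of_set X) f"
    and x: "x \<in> closure X"
    and \<U>: "countable \<U>" "\<And>U. U \<in> \<U> \<Longrightarrow> closed_neighborhood x U"
  shows "\<Inter>\<U> \<inter> X \<noteq> {}"
proof -
  \<comment> \<open>Adding \<open>UNIV\<close> makes the family non-empty, so that a sequence can enumerate it.\<close>
  define V where "V = from_nat_into (insert UNIV \<U>)"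
  have rV: "range V = insert UNIV \<U>"
    unfolding V_def by (rule range_from_nat_into) (use \<U>(1) in auto)
  have V: "closed_neighborhood x (V n)" for n
  proof -
    have "V n \<in> insert UNIV \<U>" using rV by blast
    then show ?thesis using \<U>(2) by (auto simp: closed_neighborhood_def)
  qed
  have "\<exists>s\<in>X. \<forall>n. s \<in> (\<Inter>k\<in>{..n}. V k)"
  proof (rule complete_meets_decreasing[OF st X com x])
    fix n
    have "x \<in> interior (\<Inter>k\<in>{..n}. V k)"
    proof (rule interiorI)
      show "open (\<Inter>k\<in>{..n}. interior (V k))" by (intro open_INT) auto
      show "x \<in> (\<Inter>k\<in>{..n}. interior (V k))" using V by (auto simp: closed_neighborhood_def)
      show "(\<Inter>k\<in>{..n}. interior (V k)) \<subseteq> (\<Inter>k\<in>{..n}. V k)" using interior_subset by fast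
    qed
    then show "closed_neighborhood x (\<Inter>k\<in>{..n}. V k)"
      using V by (auto simp: closed_neighborhood_def)
  qed (auto simp: antimono_def)
  then obtain s where "s \<in> X" "\<And>n. s \<in> V n" by blast
  then have "s \<in> \<Inter>\<U> \<inter> X" using rV by (auto dest: equalityD2)
  then show ?thesis by blast
qed

theorem complete_subsemilattice_closed:
  assumes st: "semitopological_semilattice f" and ol: "omega_Lawson f"
    and X: "subsemilattice f X"
    and com: "complete_topologized_semilattice (top_of_set X) f"
  shows "closed X"
proof -
  have "x \<in> X" if x: "x \<in> closure X" for x
  proof -
    define F where "F = {\<Inter>\<U> |\<U>. countable \<U> \<and> (\<forall>U\<in>\<U>. closed_neighborhood x U) \<and>
      subsemilattice f (\<Inter>\<U>)}"
    have "\<exists>a\<in>X. \<forall>K\<in>F. a \<in> K"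
    proof (rule closed_subsemilattices_meet[OF semitopological_semilatticeD(1)[OF st] X com])
      have "\<Inter>{} \<in> F" unfolding F_def by (rule CollectI, rule exI[of _ "{}"]) (auto simp: subsemilattice_def)
      then show "F \<noteq> {}" by blast
      fix K L assume "K \<in> F" "L \<in> F"
      then obtain \<U> \<V> where "K = \<Inter>\<U>" "L = \<Inter>\<V>" and
        UV: "countable \<U>" "\<forall>U\<in>\<U>. closed_neighborhood x U" "subsemilattice f (\<Inter>\<U>)"
         "countable \<V>" "\<forall>U\<in>\<V>. closed_neighborhood x U" "subsemilattice f (\<Inter>\<V>)"
        unfolding F_def by blast
      then have *: "K \<inter> L = \<Inter>(\<U> \<union> \<V>)" by auto
      show "K \<inter> L \<in> F" unfolding * F_def
      proof (intro CollectI exI conjI refl)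
        show "subsemilattice f (\<Inter>(\<U> \<union> \<V>))"
          using UV(3,6) unfolding subsemilattice_def Inter_Un_distrib by blast
      qed (use UV in auto)
    next
      fix K assume "K \<in> F"
      then obtain \<U> where U: "K = \<Inter>\<U>" "countable \<U>" "\<forall>U\<in>\<U>. closed_neighborhood x U"
          "subsemilattice f K"
        unfolding F_def by blast
      then show "closed K \<and> subsemilattice f K \<and> K \<inter> X \<noteq> {}"
        using complete_meets_countable_Inter[OF st X com x, of \<U>]
        by (auto simp: closed_neighborhood_def)
    qed
    then obtain a where a: "a \<in> X" "\<And>K. K \<in> F \<Longrightarrow> a \<in> K" by blast
    have "a = x"
    proof (rule ccontr)
      assume "a \<noteq> x"
      then obtain \<U> where "countable \<U>" "\<forall>U\<in>\<U>. closed_neighborhood x U"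
          "subsemilattice f (\<Inter>\<U>)" "a \<notin> \<Inter>\<U>"
        using ol unfolding omega_Lawson_def by metis
      then show False using a(2)[of "\<Inter>\<U>"] unfolding F_def by blast
    qed
    then show ?thesis using a(1) by simp
  qed
  then show ?thesis by (meson closure_subset_eq subsetI)
qed

section \<open>The square of a semilattice\<close>

definition pair_op :: "('a \<Rightarrow> 'a \<Rightarrow> 'a) \<Rightarrow> 'a \<times> 'a \<Rightarrow> 'a \<times> 'a \<Rightarrow> 'a \<times> 'a" where
  "pair_op f u v = (f (fst u) (fst v), f (snd u) (snd v))"

lemma natural_le_pair_op:
  "natural_le (pair_op f) u v \<longleftrightarrow> natural_le f (fst u) (fst v) \<and> natural_le f (snd u) (snd v)"
  by (auto simp: natural_le_def pair_op_def prod_eq_iff)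

lemma semilattice_pair_op:
  assumes "semilattice f" shows "semilattice (pair_op f)"
proof -
  interpret semilattice f by fact
  show ?thesis by unfold_locales (auto simp: pair_op_def ac_simps)
qed

lemma semitopological_semilattice_pair_op:
  assumes "semitopological_semilattice f"
  shows "semitopological_semilattice (pair_op f)"
proof -
  have c: "continuous_on UNIV (\<lambda>x. f a x)" "continuous_on UNIV (\<lambda>x. f x a)" for a
    using assms by (auto simp: semitopological_semilattice_def)
  have "continuous_on UNIV (\<lambda>x. pair_op f a x)" for a
    unfolding pair_op_def
    by (intro continuous_on_Pair continuous_on_compose2[OF c(1)] continuous_intros) auto
  moreover have "continuous_on UNIV (\<lambda>x. pair_op f x a)" for a
    unfolding pair_op_def
    by (intro continuous_on_Pair continuous_on_compose2[OF c(2)] continuous_intros) auto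
  ultimately show ?thesis
    using assms semilattice_pair_op by (auto simp: semitopological_semilattice_def)
qed

lemma omega_Lawson_pair_op:
  assumes ol: "omega_Lawson f"
  shows "omega_Lawson (pair_op f)"
  unfolding omega_Lawson_def
proof (intro allI impI)
  \<comment> \<open>Pairs that differ are separated by a projection, and preimages under a continuous homomorphism
    preserve closed neighborhoods and subsemilattices.\<close>
  have key: "\<exists>\<W>. countable \<W> \<and> (\<forall>W\<in>\<W>. closed_neighborhood u W) \<and>
      subsemilattice (pair_op f) (\<Inter>\<W>) \<and> v \<notin> \<Inter>\<W>"
    if neq: "\<pi> u \<noteq> \<pi> v" and cont: "continuous_on UNIV \<pi>"
      and hom: "\<And>p q. \<pi> (pair_op f p q) = f (\<pi> p) (\<pi> q)" for \<pi> :: "'a \<times> 'a \<Rightarrow> 'a" and u v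
  proof -
    obtain \<U> where \<U>: "countable \<U>" "\<forall>U\<in>\<U>. closed_neighborhood (\<pi> u) U"
        "subsemilattice f (\<Inter>\<U>)" "\<pi> v \<notin> \<Inter>\<U>"
      using ol[unfolded omega_Lawson_def, rule_format, OF neq] by blast
    have "closed_neighborhood u (\<pi> -` U)" if "U \<in> \<U>" for U
    proof -
      have U: "closed U" "\<pi> u \<in> interior U" using \<U>(2) that by (auto simp: closed_neighborhood_def)
      have "closed (\<pi> -` U)" using U(1) cont by (simp add: continuous_on_closed_vimage)
      moreover have "u \<in> interior (\<pi> -` U)"
      proof (rule interiorI)
        show "open (\<pi> -` interior U)" using cont by (simp add: continuous_on_open_vimage)
      qed (use U interior_subset in auto)
      ultimately show ?thesis by (simp add: closed_neighborhood_def)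
    qed
    moreover have "subsemilattice (pair_op f) (\<Inter>((-`) \<pi> ` \<U>))"
      using \<U>(3) hom by (auto simp: subsemilattice_def)
    ultimately show ?thesis
      using \<U>(1,4) by (intro exI[of _ "(-`) \<pi> ` \<U>"]) auto
  qed
  fix u v :: "'a \<times> 'a" assume "u \<noteq> v"
  then consider "fst u \<noteq> fst v" | "snd u \<noteq> snd v" by (auto simp: prod_eq_iff)
  then show "\<exists>\<W>. countable \<W> \<and> (\<forall>W\<in>\<W>. closed_neighborhood u W) \<and>
      subsemilattice (pair_op f) (\<Inter>\<W>) \<and> v \<notin> \<Inter>\<W>"
    by cases
      (rule key[of fst] key[of snd]; simp add: pair_op_def continuous_on_fst continuous_on_snd
        continuous_on_id)+
qed

text \<open>
  Convergence of a chain to its infimum. The chain is indexed by \<open>\<pi>\<close> on a set \<open>C\<close> with a relation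
  \<open>R\<close>, so that the two coordinate projections of one chain of pairs can be controlled from a common
  index. If the claim failed, the image points outside \<open>U\<close> would go below every member of the chain
  and thus have the infimum \<open>m\<close> as well; but then \<open>m\<close> would be in their closure, which is disjoint
  from the open set \<open>U\<close>.
\<close>

lemma complete_inf_eventually:
  assumes sl: "semilattice f" and com: "complete_topologized_semilattice (top_of_set X) f"
    and C: "\<pi> ` C \<subseteq> X" "C \<noteq> {}" "semilattice_chain f (\<pi> ` C)"
    and mono: "\<And>c d. c \<in> C \<Longrightarrow> d \<in> C \<Longrightarrow> R d c \<Longrightarrow> natural_le f (\<pi> d) (\<pi> c)"
    and m: "is_inf_in X f (\<pi> ` C) m" and U: "open U" "m \<in> U"
  shows "\<exists>c\<in>C. \<forall>d\<in>C. R d c \<longrightarrow> \<pi> d \<in> U"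
proof (rule ccontr)
  assume neg: "\<not> ?thesis"
  define S where "S = \<pi> ` {d \<in> C. \<pi> d \<notin> U}"
  have below: "\<exists>s\<in>S. natural_le f s (\<pi> c)" if "c \<in> C" for c
    using neg mono that unfolding S_def by blast
  have S: "S \<subseteq> \<pi> ` C" by (auto simp: S_def)
  have "S \<noteq> {}" using below C(2) by blast
  moreover have "semilattice_chain f S" using C(3) S unfolding semilattice_chain_def by blast
  ultimately obtain k where k: "is_inf_in X f S k" "k \<in> closure S"
    using complete_inf[OF com, of S] S C(1) by blast
  have "natural_le f k (\<pi> c)" if "c \<in> C" for c
    using below[OF that] k(1) natural_le_trans[OF sl] unfolding is_inf_in_def by blast
  then have "natural_le f k m" using m k(1) unfolding is_inf_in_def by blast
  moreover have "natural_le f m k" using m k(1) S unfolding is_inf_in_def by blast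
  ultimately have "k = m" by (rule natural_le_antisym[OF sl])
  then have "m \<in> closure S" using k(2) by simp
  moreover have "U \<inter> S = {}" by (auto simp: S_def)
  ultimately show False using U open_Int_closure_eq_empty[OF U(1), of S] by blast
qed

text \<open>
  The order dual of \<open>complete_inf_eventually\<close>.
\<close>

lemma complete_sup_eventually:
  assumes sl: "semilattice f" and com: "complete_topologized_semilattice (top_of_set X) f"
    and C: "\<pi> ` C \<subseteq> X" "C \<noteq> {}" "semilattice_chain f (\<pi> ` C)"
    and mono: "\<And>c d. c \<in> C \<Longrightarrow> d \<in> C \<Longrightarrow> R c d \<Longrightarrow> natural_le f (\<pi> c) (\<pi> d)"
    and m: "is_sup_in X f (\<pi> ` C) m" and U: "open U" "m \<in> U"
  shows "\<exists>c\<in>C. \<forall>d\<in>C. R c d \<longrightarrow> \<pi> d \<in> U"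
proof (rule ccontr)
  assume neg: "\<not> ?thesis"
  define S where "S = \<pi> ` {d \<in> C. \<pi> d \<notin> U}"
  have above: "\<exists>s\<in>S. natural_le f (\<pi> c) s" if "c \<in> C" for c
    using neg mono that unfolding S_def by blast
  have S: "S \<subseteq> \<pi> ` C" by (auto simp: S_def)
  have "S \<noteq> {}" using above C(2) by blast
  moreover have "semilattice_chain f S" using C(3) S unfolding semilattice_chain_def by blast
  ultimately obtain k where k: "is_sup_in X f S k" "k \<in> closure S"
    using complete_sup[OF com, of S] S C(1) by blast
  have "natural_le f (\<pi> c) k" if "c \<in> C" for c
    using above[OF that] k(1) natural_le_trans[OF sl] unfolding is_sup_in_def by blast
  then have "natural_le f m k" using m k(1) unfolding is_sup_in_def by blast
  moreover have "natural_le f k m" using m k(1) S unfolding is_sup_in_def by blast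
  ultimately have "k = m" by (rule natural_le_antisym[OF sl, THEN sym])
  then have "m \<in> closure S" using k(2) by simp
  moreover have "U \<inter> S = {}" by (auto simp: S_def)
  ultimately show False using U open_Int_closure_eq_empty[OF U(1), of S] by blast
qed

lemma mem_closure_Pair:
  assumes "\<And>U V. open U \<Longrightarrow> open V \<Longrightarrow> a \<in> U \<Longrightarrow> b \<in> V \<Longrightarrow> \<exists>c\<in>C. fst c \<in> U \<and> snd c \<in> V"
  shows "(a, b) \<in> closure C"
  unfolding closure_iff_nhds_not_empty
proof (intro allI impI)
  fix A W assume W: "W \<subseteq> A" "open W" "(a, b) \<in> W"
  then obtain U V where "open U" "open V" "(a, b) \<in> U \<times> V" "U \<times> V \<subseteq> W"
    by (metis open_prod_elim)
  moreover then obtain c where "c \<in> C" "fst c \<in> U" "snd c \<in> V" using assms by blast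
  ultimately have "c \<in> C \<inter> A" using W(1) by (cases c) auto
  then show "C \<inter> A \<noteq> {}" by blast
qed

lemma subsemilattice_natural_order_on:
  assumes "semilattice f" "subsemilattice f X"
  shows "subsemilattice (pair_op f) (natural_order_on X f)"
  using assms natural_le_mult[OF assms(1)]
  by (auto simp: subsemilattice_def natural_order_on_def pair_op_def)

text \<open>
  Bounds are computed coordinatewise. That they lie in the closure of the chain uses convergence:
  both coordinates are eventually in given neighborhoods, and of two indices in a chain, the one
  further along serves both coordinates.
\<close>

lemma complete_natural_order_on:
  assumes sl: "semilattice f" and com: "complete_topologized_semilattice (top_of_set X) f"
  shows "complete_topologized_semilattice (top_of_set (natural_order_on X f)) (pair_op f)"
  unfolding complete_topologized_semilattice_iff
proof (intro allI impI conjI; elim conjE)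
  note slp = semilattice_pair_op[OF sl]
  fix C assume C: "C \<subseteq> natural_order_on X f" "C \<noteq> {}" "semilattice_chain (pair_op f) C"
  let ?R = "natural_le (pair_op f)"
  have lin: "?R c d \<or> ?R d c" if "c \<in> C" "d \<in> C" for c d
    using C(3) that unfolding semilattice_chain_iff[OF slp] by blast
  have CX: "fst ` C \<subseteq> X" "snd ` C \<subseteq> X" using C(1) by (auto simp: natural_order_on_def)
  have Cle: "natural_le f (fst c) (snd c)" if "c \<in> C" for c
    using C(1) that by (auto simp: natural_order_on_def)
  have Cc: "semilattice_chain f (fst ` C)" "semilattice_chain f (snd ` C)"
    unfolding semilattice_chain_iff[OF sl] using lin by (auto simp: natural_le_pair_op)
  have ne: "fst ` C \<noteq> {}" "snd ` C \<noteq> {}" using C(2) by auto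
  show "\<exists>m. is_inf_in (natural_order_on X f) (pair_op f) C m \<and> m \<in> closure C"
  proof -
    obtain a where a: "is_inf_in X f (fst ` C) a" using complete_inf[OF com CX(1) ne(1) Cc(1)] by blast
    obtain b where b: "is_inf_in X f (snd ` C) b" using complete_inf[OF com CX(2) ne(2) Cc(2)] by blast
    have "natural_le f a (snd c)" if "c \<in> C" for c
      using a Cle[OF that] that natural_le_trans[OF sl] unfolding is_inf_in_def by blast
    then have ab: "natural_le f a b" using a b unfolding is_inf_in_def by blast
    have "is_inf_in (natural_order_on X f) (pair_op f) C (a, b)"
      using a b ab unfolding is_inf_in_def natural_order_on_def by (auto simp: natural_le_pair_op)
    moreover have "(a, b) \<in> closure C"
    proof (rule mem_closure_Pair)
      fix U V :: "'a set" assume UV: "open U" "open V" "a \<in> U" "b \<in> V"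
      obtain c where c: "c \<in> C" "\<And>e. e \<in> C \<Longrightarrow> ?R e c \<Longrightarrow> fst e \<in> U"
        using complete_inf_eventually[OF sl com CX(1) C(2) Cc(1) _ a UV(1,3), of ?R]
        by (auto simp: natural_le_pair_op)
      obtain d where d: "d \<in> C" "\<And>e. e \<in> C \<Longrightarrow> ?R e d \<Longrightarrow> snd e \<in> V"
        using complete_inf_eventually[OF sl com CX(2) C(2) Cc(2) _ b UV(2,4), of ?R]
        by (auto simp: natural_le_pair_op)
      show "\<exists>c\<in>C. fst c \<in> U \<and> snd c \<in> V"
        using lin[OF c(1) d(1)] c d natural_le_refl[OF slp] by blast
    qed
    ultimately show ?thesis by blast
  qed
  show "\<exists>m. is_sup_in (natural_order_on X f) (pair_op f) C m \<and> m \<in> closure C"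
  proof -
    obtain a where a: "is_sup_in X f (fst ` C) a" using complete_sup[OF com CX(1) ne(1) Cc(1)] by blast
    obtain b where b: "is_sup_in X f (snd ` C) b" using complete_sup[OF com CX(2) ne(2) Cc(2)] by blast
    have "natural_le f (fst c) b" if "c \<in> C" for c
      using b Cle[OF that] that natural_le_trans[OF sl] unfolding is_sup_in_def by blast
    then have ab: "natural_le f a b" using a b unfolding is_sup_in_def by blast
    have "is_sup_in (natural_order_on X f) (pair_op f) C (a, b)"
      using a b ab unfolding is_sup_in_def natural_order_on_def by (auto simp: natural_le_pair_op)
    moreover have "(a, b) \<in> closure C"
    proof (rule mem_closure_Pair)
      fix U V :: "'a set" assume UV: "open U" "open V" "a \<in> U" "b \<in> V"
      obtain c where c: "c \<in> C" "\<And>e. e \<in> C \<Longrightarrow> ?R c e \<Longrightarrow> fst e \<in> U"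
        using complete_sup_eventually[OF sl com CX(1) C(2) Cc(1) _ a UV(1,3), of ?R]
        by (auto simp: natural_le_pair_op)
      obtain d where d: "d \<in> C" "\<And>e. e \<in> C \<Longrightarrow> ?R d e \<Longrightarrow> snd e \<in> V"
        using complete_sup_eventually[OF sl com CX(2) C(2) Cc(2) _ b UV(2,4), of ?R]
        by (auto simp: natural_le_pair_op)
      show "\<exists>c\<in>C. fst c \<in> U \<and> snd c \<in> V"
        using lin[OF c(1) d(1)] c d natural_le_refl[OF slp] by blast
    qed
    ultimately show ?thesis by blast
  qed
qed

theorem theorem6:
  fixes f :: "'a::topological_space \<Rightarrow> 'a \<Rightarrow> 'a"
    and X :: "'a set"
  assumes "semitopological_semilattice f"
    and "omega_Lawson f"
    and "subsemilattice f X"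
    and "complete_topologized_semilattice (top_of_set X) f"
  shows "closed (natural_order_on X f) \<and> closed X"
proof
  note sl = semitopological_semilatticeD(1)[OF assms(1)]
  show cl: "closed (natural_order_on X f)"
    by (rule complete_subsemilattice_closed[OF semitopological_semilattice_pair_op omega_Lawson_pair_op
          subsemilattice_natural_order_on complete_natural_order_on]) (use assms sl in auto)
  have "X = (\<lambda>x. (x, x)) -` natural_order_on X f"
    using natural_le_refl[OF sl] by (auto simp: natural_order_on_def)
  moreover have "closed ((\<lambda>x. (x, x)) -` natural_order_on X f)"
    by (intro closed_vimage cl continuous_on_Pair continuous_on_id)
  ultimately show "closed X" by simp
qed

end
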